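(* Let $G$ be a connected 4-regular graph and let $v,w$ be adjacent vertices of $G$ such that the neighbours of $w$ are exactly $v,a,b,c$ and the neighbours of $v$ are exactly $w,c,d,e$, where $a,b,c,d,e$ are distinct. Let $S=G-\{v,w\}$. Then there is a fixed-point free involution on \[ \mathcal{S}_{\{a\},\{b,c,d,e\}} \cup \mathcal{S}_{\{b\},\{a,c,d,e\}} \cup \mathcal{S}_{\{d\},\{a,b,c,e\}} \cup \mathcal{S}_{\{e\},\{a,b,c,d\}}, \] and thus \[ s_{\{a\},\{b,c,d,e\}} + s_{\{b\},\{a,c,d,e\}} + s_{\{d\},\{a,b,c,e\}} + s_{\{e\},\{a,b,c,d\}} \equiv 0 \pmod 2. \]
   Context: $G-\{v,w\}$ is the graph obtained by deleting $v,w$ and all incident edges. A spanning 2-forest of a graph is a spanning forest with exactly two trees. If $P=P_1\cup P_2$ is a bipartition of a set of vertices, a spanning 2-forest is compatible with $P$ if one of its trees contains all vertices of $P_1$ and none of $P_2$, and the other contains all vertices of $P_2$ and none of $P_1$. For a bipartition $P$ of $\{a,b,c,d,e\}$, $\mathcal{S}_P$ is the set of bipartitions $(\psi,\phi)$ of the edge set of $S$ such that $\psi$ is a spanning tree of $S$ and $\phi$ is a spanning 2-forest of $S$ compatible with $P$; $s_P=|\mathcal{S}_P|$. *)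

theory Defs
  imports "HOL-Number_Theory.Cong"
begin

text \<open>
  Undirected graphs; parallel edges and loops are permitted. Edges have an identity of their
  own, and \<open>ends\<close> maps an edge to its set of endpoints (a singleton for a loop).
\<close>

record ('v, 'e) graph =
  verts :: "'v set"
  edges :: "'e set"
  ends :: "'e \<Rightarrow> 'v set"

definition finite_graph :: "('v, 'e) graph \<Rightarrow> bool" where
  "finite_graph G \<longleftrightarrow> finite (verts G) \<and> finite (edges G) \<and>
     (\<forall>x\<in>edges G. ends G x \<subseteq> verts G \<and> card (ends G x) \<in> {1, 2})"

text \<open>A loop contributes 2 to the degree of its vertex.\<close>

definition degree :: "('v, 'e) graph \<Rightarrow> 'v \<Rightarrow> nat" where
  "degree G u = card {x \<in> edges G. u \<in> ends G x} + card {x \<in> edges G. ends G x = {u}}"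

definition regular :: "nat \<Rightarrow> ('v, 'e) graph \<Rightarrow> bool" where
  "regular k G \<longleftrightarrow> (\<forall>u\<in>verts G. degree G u = k)"

definition adjacent :: "('v, 'e) graph \<Rightarrow> 'v \<Rightarrow> 'v \<Rightarrow> bool" where
  "adjacent G u u' \<longleftrightarrow> (\<exists>x\<in>edges G. ends G x = {u, u'})"

definition neighbours :: "('v, 'e) graph \<Rightarrow> 'v \<Rightarrow> 'v set" where
  "neighbours G u = {u'. adjacent G u u'}"

definition delete_verts :: "('v, 'e) graph \<Rightarrow> 'v set \<Rightarrow> ('v, 'e) graph" where
  "delete_verts G X =
     G\<lparr>verts := verts G - X, edges := {x \<in> edges G. ends G x \<inter> X = {}}\<rparr>"

definition reachable :: "('v, 'e) graph \<Rightarrow> ('v \<times> 'v) set" where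
  "reachable G = {(u, u'). u \<in> verts G \<and> u' \<in> verts G \<and> (adjacent G)\<^sup>*\<^sup>* u u'}"

definition components :: "('v, 'e) graph \<Rightarrow> 'v set set" where
  "components G = verts G // reachable G"

definition connected_graph :: "('v, 'e) graph \<Rightarrow> bool" where
  "connected_graph G \<longleftrightarrow> verts G \<noteq> {} \<and> (\<forall>u\<in>verts G. \<forall>u'\<in>verts G. (u, u') \<in> reachable G)"

text \<open>
  The cycle visits the vertices \<open>us\<close> in order, \<open>xs ! i\<close> being the edge from \<open>us ! i\<close> to its
  cyclic successor. A loop is a cycle of length 1, two parallel edges form a cycle of length 2.
\<close>

definition is_cycle :: "('v, 'e) graph \<Rightarrow> 'v list \<Rightarrow> 'e list \<Rightarrow> bool" where
  "is_cycle G us xs \<longleftrightarrow> xs \<noteq> [] \<and> length us = length xs \<and> distinct us \<and> distinct xs \<and>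
     set us \<subseteq> verts G \<and> set xs \<subseteq> edges G \<and>
     (\<forall>i<length xs. ends G (xs ! i) = {us ! i, us ! (Suc i mod length us)})"

definition forest :: "('v, 'e) graph \<Rightarrow> bool" where
  "forest G \<longleftrightarrow> \<not> (\<exists>us xs. is_cycle G us xs)"

definition tree :: "('v, 'e) graph \<Rightarrow> bool" where
  "tree G \<longleftrightarrow> connected_graph G \<and> forest G"

text \<open>
  Spanning subgraphs are given by their edge sets: \<open>G\<lparr>edges := F\<rparr>\<close> keeps all vertices of \<open>G\<close>.
  The trees of a forest are its connected components, represented by their vertex sets.
\<close>

definition spanning_tree :: "('v, 'e) graph \<Rightarrow> 'e set \<Rightarrow> bool" where
  "spanning_tree G F \<longleftrightarrow> F \<subseteq> edges G \<and> tree (G\<lparr>edges := F\<rparr>)"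

definition spanning_2_forest :: "('v, 'e) graph \<Rightarrow> 'e set \<Rightarrow> bool" where
  "spanning_2_forest G F \<longleftrightarrow>
     F \<subseteq> edges G \<and> forest (G\<lparr>edges := F\<rparr>) \<and> card (components (G\<lparr>edges := F\<rparr>)) = 2"

definition compatible :: "('v, 'e) graph \<Rightarrow> 'e set \<Rightarrow> 'v set \<Rightarrow> 'v set \<Rightarrow> bool" where
  "compatible G F P1 P2 \<longleftrightarrow>
     (\<exists>T1 T2. components (G\<lparr>edges := F\<rparr>) = {T1, T2} \<and> T1 \<noteq> T2 \<and>
        P1 \<subseteq> T1 \<and> P2 \<inter> T1 = {} \<and> P2 \<subseteq> T2 \<and> P1 \<inter> T2 = {})"

text \<open>The set \<open>\<S>\<^sub>P\<close> and its cardinality \<open>s\<^sub>P\<close> for \<open>P = P1 \<union> P2\<close>.\<close>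

definition tree_forest_pairs ::
    "('v, 'e) graph \<Rightarrow> 'v set \<Rightarrow> 'v set \<Rightarrow> ('e set \<times> 'e set) set" where
  "tree_forest_pairs S P1 P2 =
     {(\<psi>, \<phi>). \<psi> \<union> \<phi> = edges S \<and> \<psi> \<inter> \<phi> = {} \<and>
        spanning_tree S \<psi> \<and> spanning_2_forest S \<phi> \<and> compatible S \<phi> P1 P2}"

definition num_tree_forest_pairs :: "('v, 'e) graph \<Rightarrow> 'v set \<Rightarrow> 'v set \<Rightarrow> nat" where
  "num_tree_forest_pairs S P1 P2 = card (tree_forest_pairs S P1 P2)"

definition fixed_point_free_involution_on :: "'a set \<Rightarrow> ('a \<Rightarrow> 'a) \<Rightarrow> bool" where
  "fixed_point_free_involution_on A f \<longleftrightarrow> (\<forall>x\<in>A. f x \<in> A \<and> f (f x) = x \<and> f x \<noteq> x)"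

end

theory Submission
  imports Defs
begin

text \<open>
  Join two tree-forest bipartitions \<open>(\<psi>, \<phi>)\<close> and \<open>(\<phi> \<union> {g}, \<psi> - {g})\<close> of the edges of \<open>S\<close> by an edge,
  for every \<open>g \<in> \<psi>\<close> that connects the two trees of \<open>\<phi>\<close>. For fixed vertices \<open>s\<close>, \<open>t\<close> let \<open>Y\<close> be the set
  of bipartitions whose forest separates \<open>s\<close> from \<open>t\<close>. The neighbour given by \<open>g\<close> is in \<open>Y\<close> iff \<open>g\<close> lies
  on the \<open>s\<close>-\<open>t\<close>-path of \<open>\<psi>\<close>, and this path changes between the two trees of \<open>\<phi>\<close> an odd number of
  times iff \<open>\<phi>\<close> separates \<open>s\<close> from \<open>t\<close>. So every vertex has an odd number of neighbours in \<open>Y\<close> if it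
  is in \<open>Y\<close>, and an even number otherwise; by the handshake lemma, the number of elements of \<open>Y\<close> of
  odd degree is even. Since \<open>G\<close> is 4-regular, the degree of \<open>(\<psi>, \<phi>)\<close> has the parity of the number of
  vertices among \<open>a, b, d, e\<close> in one tree of \<open>\<phi>\<close>.

  The vertex \<open>c\<close> has two edges in \<open>S\<close>, say to \<open>p\<close> and \<open>q\<close>, and exchanging them between \<open>\<psi>\<close> and \<open>\<phi>\<close>
  pairs off the bipartitions in question, except those where \<open>c\<close> thereby changes sides. These are
  in bijection with the odd-degree elements of \<open>Y\<close> for \<open>s = c\<close>, \<open>t = q\<close>, so the total is even, and a
  fixed-point free involution exists on every finite set of even size.
\<close>

section \<open>Parity and involutions\<close>

lemma even_card_involution:
  assumes "finite A" and "\<And>x. x \<in> A \<Longrightarrow> f x \<in> A \<and> f (f x) = x \<and> f x \<noteq> x"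
  shows "even (card A)"
  using assms
proof (induction A rule: finite_psubset_induct)
  case (psubset A)
  show ?case
  proof (cases "A = {}")
    case False
    then obtain x where x: "x \<in> A" by blast
    let ?B = "A - {x, f x}"
    have "f y \<in> ?B \<and> f (f y) = y \<and> f y \<noteq> y" if "y \<in> ?B" for y
      using that psubset.prems[of y] psubset.prems[of x] x by auto
    then have "even (card ?B)"
      using psubset.IH[of ?B] x by blast
    moreover have "card A = card ?B + 2"
    proof -
      have "card {x, f x} = 2" "{x, f x} \<subseteq> A"
        using psubset.prems[of x] x by auto
      then show ?thesis
        using card_Diff_subset[of "{x, f x}" A] card_mono[OF psubset.hyps(1), of "{x, f x}"]
          finite_subset[OF _ psubset.hyps(1)] by simp
    qed
    ultimately show ?thesis by simp
  qed simp
qed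

lemma even_card_imp_involution:
  assumes "finite A" and "even (card A)"
  shows "\<exists>f. fixed_point_free_involution_on A f"
  using assms
proof (induction A rule: finite_psubset_induct)
  case (psubset A)
  show ?case
  proof (cases "A = {}")
    case True
    then show ?thesis by (simp add: fixed_point_free_involution_on_def)
  next
    case False
    then obtain x where x: "x \<in> A" by blast
    have "A \<noteq> {x}" using psubset.prems by auto
    then obtain y where y: "y \<in> A" "y \<noteq> x" using x by blast
    let ?B = "A - {x, y}"
    have "card A = card ?B + 2"
      using x y card_Diff_subset[of "{x, y}" A] card_mono[OF psubset.hyps(1), of "{x, y}"]
      by simp
    then have "even (card ?B)" using psubset.prems by simp
    then obtain f where f: "fixed_point_free_involution_on ?B f"
      using psubset.IH[of ?B] x by blast
    have "fixed_point_free_involution_on A (f(x := y, y := x))"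
      using f x y unfolding fixed_point_free_involution_on_def by auto
    then show ?thesis by blast
  qed
qed

lemma sum_card_swap:
  assumes "finite A" "finite B"
  shows "(\<Sum>x\<in>A. card {y \<in> B. R x y}) = (\<Sum>y\<in>B. card {x \<in> A. R x y})"
proof -
  have "(\<Sum>x\<in>A. card {y \<in> B. R x y}) = (\<Sum>x\<in>A. \<Sum>y\<in>B. if R x y then 1 else 0)"
    using assms by (simp add: sum.If_cases Int_def)
  also have "\<dots> = (\<Sum>y\<in>B. \<Sum>x\<in>A. if R x y then 1 else 0)"
    by (rule sum.swap)
  also have "\<dots> = (\<Sum>y\<in>B. card {x \<in> A. R x y})"
    using assms by (simp add: sum.If_cases Int_def)
  finally show ?thesis .
qed

lemma even_sum_degrees:
  assumes "finite Y"
    and "\<And>x y. x \<in> Y \<Longrightarrow> y \<in> Y \<Longrightarrow> R x y \<Longrightarrow> R y x"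
    and "\<And>x. x \<in> Y \<Longrightarrow> \<not> R x x"
  shows "even (\<Sum>y\<in>Y. card {x \<in> Y. R y x})"
proof -
  have "(\<Sum>y\<in>Y. card {x \<in> Y. R y x}) = card (SIGMA y:Y. {x \<in> Y. R y x})"
    using assms(1) by simp
  moreover have "even (card (SIGMA y:Y. {x \<in> Y. R y x}))"
    by (rule even_card_involution[where f = "\<lambda>(x, y). (y, x)"])
      (use assms in auto)
  ultimately show ?thesis by simp
qed

text \<open>Sum over \<open>Y\<close> the degrees in \<open>X\<close>. Relations inside
  \<open>Y\<close> are counted twice, and those leaving \<open>Y\<close> can be counted from their
  outer ends, each of which contributes an even number by \<open>par\<close>. An even sum has an
  even number of odd terms.\<close>

lemma even_card_odd_degree:
  assumes "finite X" "Y \<subseteq> X"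
    and sym: "\<And>x y. x \<in> X \<Longrightarrow> y \<in> X \<Longrightarrow> R x y \<Longrightarrow> R y x"
    and irr: "\<And>x. x \<in> X \<Longrightarrow> \<not> R x x"
    and par: "\<And>x. x \<in> X \<Longrightarrow> odd (card {y \<in> Y. R x y}) \<longleftrightarrow> x \<in> Y"
  shows "even (card {y \<in> Y. odd (card {x \<in> X. R y x})})"
proof -
  have fin: "finite Y" using assms finite_subset by blast
  have "card {x \<in> X. R y x} = card {x \<in> Y. R y x} + card {x \<in> X - Y. R y x}" for y
  proof -
    have "{x \<in> X. R y x} = {x \<in> Y. R y x} \<union> {x \<in> X - Y. R y x}" using assms(2) by blast
    then show ?thesis using assms(1) fin by (simp add: card_Un_disjoint disjoint_iff)
  qed
  then have "(\<Sum>y\<in>Y. card {x \<in> X. R y x}) =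
      (\<Sum>y\<in>Y. card {x \<in> Y. R y x}) + (\<Sum>y\<in>Y. card {x \<in> X - Y. R y x})"
    by (simp add: sum.distrib)
  moreover have "even (\<Sum>y\<in>Y. card {x \<in> Y. R y x})"
    using fin sym irr assms(2) by (intro even_sum_degrees) auto
  moreover have "even (\<Sum>y\<in>Y. card {x \<in> X - Y. R y x})"
  proof -
    have "(\<Sum>y\<in>Y. card {x \<in> X - Y. R y x}) = (\<Sum>x\<in>X - Y. card {y \<in> Y. R y x})"
      using assms(1) fin by (intro sum_card_swap) auto
    moreover have "{y \<in> Y. R y x} = {y \<in> Y. R x y}" if "x \<in> X - Y" for x
      using that sym assms(2) by blast
    moreover have "even (card {y \<in> Y. R x y})" if "x \<in> X - Y" for x
      using that par by blast
    ultimately show ?thesis by (auto intro!: dvd_sum)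
  qed
  ultimately have "even (\<Sum>y\<in>Y. card {x \<in> X. R y x})" by simp
  then show ?thesis by (simp add: even_sum_iff[OF fin])
qed

section \<open>Connectivity and forests\<close>

text \<open>Adjacency does not consult \<open>verts S\<close>, so this relation lives on the whole
  type and is reflexive everywhere. That it stays inside \<open>verts S\<close> is the content of
  \<open>linked_verts\<close>.\<close>

definition linked :: "('v, 'e) graph \<Rightarrow> 'e set \<Rightarrow> 'v \<Rightarrow> 'v \<Rightarrow> bool" where
  "linked S F = (adjacent (S\<lparr>edges := F\<rparr>))\<^sup>*\<^sup>*"

lemma adjacent_edges: "adjacent (S\<lparr>edges := F\<rparr>) u z \<longleftrightarrow> (\<exists>x\<in>F. ends S x = {u, z})"
  by (simp add: adjacent_def)

lemma linked_refl [simp]: "linked S F u u"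
  by (simp add: linked_def)

lemma linked_edge: "x \<in> F \<Longrightarrow> ends S x = {u, z} \<Longrightarrow> linked S F u z"
  unfolding linked_def by (rule r_into_rtranclp) (auto simp: adjacent_edges)

lemma linked_trans [trans]: "linked S F u z \<Longrightarrow> linked S F z y \<Longrightarrow> linked S F u y"
  unfolding linked_def by (rule rtranclp_trans)

lemma linked_sym: "linked S F u z \<Longrightarrow> linked S F z u"
proof -
  have "symp (adjacent (S\<lparr>edges := F\<rparr>))"
    by (auto simp: symp_def adjacent_edges insert_commute)
  then show "linked S F u z \<Longrightarrow> linked S F z u"
    unfolding linked_def by (metis symp_def symp_rtranclp)
qed

lemma linked_commute: "linked S F u z \<longleftrightarrow> linked S F z u"
  using linked_sym by metis

lemma linked_cong: "linked S F u z \<Longrightarrow> linked S F u y \<longleftrightarrow> linked S F z y"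
  using linked_sym linked_trans by metis

lemma linked_mono: "F \<subseteq> F' \<Longrightarrow> linked S F u z \<Longrightarrow> linked S F' u z"
  unfolding linked_def
  by (erule rtranclp_mono[THEN predicate2D, rotated]) (fastforce simp: adjacent_edges)

text \<open>A walk may use \<open>g\<close> several times, but one passage always suffices: crossing
  back cancels an earlier crossing. Most later facts on adding or removing an edge reduce to this
  formula.\<close>

lemma linked_insert:
  assumes "ends S g = {x, y}"
  shows "linked S (insert g F) u z \<longleftrightarrow>
    linked S F u z \<or> linked S F u x \<and> linked S F y z \<or> linked S F u y \<and> linked S F x z"
    (is "?L \<longleftrightarrow> ?R z")
proof
  assume ?L
  then show "?R z"
    unfolding linked_def[of S "insert g F"]
  proof (induction rule: rtranclp_induct)
    case (step t t')
    then obtain h where h: "h \<in> insert g F" "ends S h = {t, t'}" by (auto simp: adjacent_edges)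
    show ?case
    proof (cases "h \<in> F")
      case True
      then show ?thesis using step.IH h linked_edge linked_trans by metis
    next
      case False
      then have "{t, t'} = {x, y}" using h assms by auto
      then show ?thesis using step.IH by (auto simp: doubleton_eq_iff)
    qed
  qed simp
next
  have "linked S (insert g F) x y" using assms by (intro linked_edge) auto
  moreover have "linked S (insert g F) u' z'" if "linked S F u' z'" for u' z'
    using that linked_mono by (metis subset_insertI)
  ultimately show "?R z \<Longrightarrow> ?L" using linked_trans linked_sym by metis
qed

lemma linked_verts:
  assumes "finite_graph S" "F \<subseteq> edges S" "linked S F u z" "u \<in> verts S"
  shows "z \<in> verts S"
  using assms(3,4) unfolding linked_def
proof (induction rule: rtranclp_induct)
  case (step y z)
  then show ?case using assms(1,2) unfolding finite_graph_def adjacent_edges by blast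
qed

lemma ends_cases:
  assumes "finite_graph S" "g \<in> edges S"
  obtains x y where "ends S g = {x, y}" "x \<in> verts S" "y \<in> verts S"
proof -
  have "card (ends S g) = 1 \<or> card (ends S g) = 2" "ends S g \<subseteq> verts S"
    using assms unfolding finite_graph_def by auto
  then show ?thesis using that by (auto simp: card_1_singleton_iff card_2_iff)
qed

text \<open>An edge lies on a cycle iff its ends stay linked after its removal. This form avoids
  vertex and edge lists; a loop is excluded because \<open>linked\<close> is reflexive.\<close>

definition circuit_free :: "('v, 'e) graph \<Rightarrow> 'e set \<Rightarrow> bool" where
  "circuit_free S F \<longleftrightarrow> (\<forall>g\<in>F. \<forall>x y. ends S g = {x, y} \<longrightarrow> \<not> linked S (F - {g}) x y)"

lemma rtranclp_distinct_path:
  assumes "r\<^sup>*\<^sup>* x y"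
  obtains us where "us \<noteq> []" "distinct us" "hd us = x" "last us = y" "successively r us"
proof -
  have "\<exists>us. us \<noteq> [] \<and> distinct us \<and> hd us = x \<and> last us = y \<and> successively r us"
    using assms
  proof (induction rule: rtranclp_induct)
    case base
    show ?case by (rule exI[of _ "[x]"]) simp
  next
    case (step y z)
    then obtain us where us: "us \<noteq> []" "distinct us" "hd us = x" "last us = y" "successively r us"
      by blast
    show ?case
    proof (cases "z \<in> set us")
      \<comment> \<open>If the walk returns to a vertex already visited, the path is cut back to
        that visit.\<close>
      case True
      then obtain ps qs where "us = ps @ z # qs" by (meson split_list)
      with us show ?thesis
        by (intro exI[of _ "ps @ [z]"]) (auto simp: successively_append_iff hd_append)
    next
      case False
      with us step.hyps show ?thesis
        by (intro exI[of _ "us @ [z]"]) (auto simp: successively_append_iff)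
    qed
  qed
  then show ?thesis using that by blast
qed

lemma forest_imp_circuit_free:
  assumes "finite_graph S" "F \<subseteq> edges S" "forest (S\<lparr>edges := F\<rparr>)"
  shows "circuit_free S F"
  unfolding circuit_free_def
proof (intro ballI allI impI notI)
  fix g x y
  assume g: "g \<in> F" "ends S g = {x, y}" and "linked S (F - {g}) x y"
  then obtain us where us: "us \<noteq> []" "distinct us" "hd us = x" "last us = y"
      "successively (adjacent (S\<lparr>edges := F - {g}\<rparr>)) us"
    unfolding linked_def by (metis rtranclp_distinct_path)
  define n where "n = length us - 1"
  have len: "length us = Suc n" using us(1) by (simp add: n_def)
  have "\<exists>h\<in>F - {g}. ends S h = {us ! i, us ! Suc i}" if "i < n" for i
    using us(5) that len by (simp add: successively_conv_nth adjacent_edges)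
  then obtain h where h: "\<And>i. i < n \<Longrightarrow> h i \<in> F - {g} \<and> ends S (h i) = {us ! i, us ! Suc i}"
    by metis
  \<comment> \<open>The path from \<open>x\<close> to \<open>y\<close> avoids \<open>g\<close>, and
    \<open>g\<close> closes it to a cycle. For a loop, \<open>n\<close> is 0 and \<open>xs\<close>
    is just \<open>[g]\<close>.\<close>
  define xs where "xs = map h [0..<n] @ [g]"
  have "inj_on h {0..<n}"
  proof (rule inj_onI)
    fix i j assume ij: "i \<in> {0..<n}" "j \<in> {0..<n}" "h i = h j"
    then have "{us ! i, us ! Suc i} = {us ! j, us ! Suc j}" using h by (metis atLeastLessThan_iff)
    then show "i = j"
      using ij len us(2) by (auto simp: doubleton_eq_iff nth_eq_iff_index_eq)
  qed
  then have "distinct xs" using h by (fastforce simp: xs_def distinct_map)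
  moreover have "us ! 0 = x" "us ! n = y"
    using us len by (simp_all add: hd_conv_nth last_conv_nth)
  then have "ends S (xs ! i) = {us ! i, us ! (Suc i mod length us)}" if "i < length xs" for i
    using that h g len by (cases "i = n") (auto simp: xs_def nth_append)
  moreover have "set xs \<subseteq> F" using h g by (auto simp: xs_def)
  moreover have "set us \<subseteq> verts S"
  proof
    fix u assume "u \<in> set us"
    then obtain i where i: "i < Suc n" "u = us ! i" using len by (metis in_set_conv_nth)
    have "xs ! i \<in> F" using \<open>set xs \<subseteq> F\<close> i nth_mem[of i xs] by (auto simp: xs_def)
    then have "ends S (xs ! i) \<subseteq> verts S" using assms(1,2) unfolding finite_graph_def by blast
    then show "u \<in> verts S" using calculation(2)[of i] i by (auto simp: xs_def)
  qed
  ultimately have "is_cycle (S\<lparr>edges := F\<rparr>) us xs"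
    using us(2) len unfolding is_cycle_def by (auto simp: xs_def)
  then show False using assms(3) unfolding forest_def by blast
qed

lemma circuit_free_imp_forest:
  assumes "circuit_free S F"
  shows "forest (S\<lparr>edges := F\<rparr>)"
  unfolding forest_def
proof (intro notI, elim exE)
  fix us xs assume cyc: "is_cycle (S\<lparr>edges := F\<rparr>) us xs"
  define n where "n = length xs - 1"
  have len: "length xs = Suc n" "length us = Suc n"
    using cyc unfolding is_cycle_def n_def by auto
  \<comment> \<open>The closing edge of the cycle is the one to refute: the remaining edges already
    link its two ends.\<close>
  let ?g = "xs ! n"
  have e: "ends S (xs ! i) = {us ! i, us ! (Suc i mod Suc n)}" if "i < Suc n" for i
    using cyc that len unfolding is_cycle_def by auto
  have mem: "xs ! i \<in> F" if "i < Suc n" for i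
    using cyc that len nth_mem[of i xs] unfolding is_cycle_def by auto
  have "linked S (F - {?g}) (us ! 0) (us ! i)" if "i < Suc n" for i
    using that
  proof (induction i)
    case (Suc i)
    have "xs ! i \<noteq> ?g"
      using cyc Suc.prems len nth_eq_iff_index_eq[of xs i n] unfolding is_cycle_def by auto
    then have "linked S (F - {?g}) (us ! i) (us ! Suc i)"
      using mem[of i] e[of i] Suc.prems by (intro linked_edge[of "xs ! i"]) auto
    then show ?case using Suc linked_trans by (metis Suc_lessD)
  qed simp
  then have "linked S (F - {?g}) (us ! n) (us ! 0)" using linked_sym by (metis lessI)
  moreover have "ends S ?g = {us ! n, us ! 0}" using e[of n] by simp
  ultimately show False using assms mem[of n] unfolding circuit_free_def by blast
qed

lemma forest_iff_circuit_free:
  "finite_graph S \<Longrightarrow> F \<subseteq> edges S \<Longrightarrow> forest (S\<lparr>edges := F\<rparr>) \<longleftrightarrow> circuit_free S F"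
  using forest_imp_circuit_free circuit_free_imp_forest by metis

lemma circuit_free_subset: "circuit_free S F' \<Longrightarrow> F \<subseteq> F' \<Longrightarrow> circuit_free S F"
  unfolding circuit_free_def by (blast dest: linked_mono[rotated, of S "F - {_}" _ _ "F' - {_}"])

text \<open>A new circuit through \<open>h\<close> must pass through \<open>g\<close>, and the rest
  of that circuit would link the ends of \<open>g\<close> within \<open>F\<close>.\<close>

lemma circuit_free_insert:
  assumes "circuit_free S F" "ends S g = {x, y}" "\<not> linked S F x y"
  shows "circuit_free S (insert g F)"
  unfolding circuit_free_def
proof (intro ballI allI impI notI)
  fix h u z
  assume h: "h \<in> insert g F" "ends S h = {u, z}" and l: "linked S (insert g F - {h}) u z"
  show False
  proof (cases "h = g")
    case True
    then have "linked S F u z" using l by (elim linked_mono[rotated]) auto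
    moreover have "{u, z} = {x, y}" using True h assms by auto
    ultimately show False using assms(3) linked_sym by (metis doubleton_eq_iff)
  next
    case False
    then have hF: "h \<in> F" and eq: "insert g F - {h} = insert g (F - {h})" using h by auto
    have m: "linked S F u' z'" if "linked S (F - {h}) u' z'" for u' z'
      using that by (elim linked_mono[rotated]) auto
    have "\<not> linked S (F - {h}) u z" using assms(1) hF h(2) unfolding circuit_free_def by blast
    then have "linked S F u x \<and> linked S F y z \<or> linked S F u y \<and> linked S F x z"
      using l m unfolding eq linked_insert[OF assms(2)] by blast
    moreover have "linked S F u z" using hF h(2) by (rule linked_edge)
    ultimately show False using assms(3) linked_sym linked_trans by metis
  qed
qed

section \<open>Exchanging an edge between tree and 2-forest\<close>

text \<open>Exactly two components, expressed by representatives \<open>r\<close> and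
  \<open>s\<close> instead of a set of classes.\<close>

definition bisected :: "('v, 'e) graph \<Rightarrow> 'e set \<Rightarrow> bool" where
  "bisected S F \<longleftrightarrow> (\<exists>r\<in>verts S. \<exists>s\<in>verts S. \<not> linked S F r s \<and>
     (\<forall>u\<in>verts S. linked S F r u \<or> linked S F s u))"

definition spans :: "('v, 'e) graph \<Rightarrow> 'e set \<Rightarrow> bool" where
  "spans S F \<longleftrightarrow> (\<forall>u\<in>verts S. \<forall>z\<in>verts S. linked S F u z)"

text \<open>A bipartition is encoded by its 2-forest alone, the tree being the complement in
  \<open>edges S\<close>. Compatibility is left out, because exchanges may change which vertices are
  separated.\<close>

definition tree_complements :: "('v, 'e) graph \<Rightarrow> 'e set set" where
  "tree_complements S = {F. F \<subseteq> edges S \<and> circuit_free S F \<and> bisected S F \<and>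
     circuit_free S (edges S - F) \<and> spans S (edges S - F)}"

definition crosses :: "('v, 'e) graph \<Rightarrow> 'e set \<Rightarrow> 'e \<Rightarrow> bool" where
  "crosses S F g \<longleftrightarrow> (\<exists>x y. ends S g = {x, y} \<and> \<not> linked S F x y)"

lemma crosses_iff: "ends S g = {x, y} \<Longrightarrow> crosses S F g \<longleftrightarrow> \<not> linked S F x y"
  unfolding crosses_def by (metis doubleton_eq_iff linked_sym)

text \<open>Any two unlinked vertices can take the place of the representatives in
  \<open>bisected\<close>.\<close>

lemma bisected_not_linked:
  assumes "bisected S F" "x \<in> verts S" "y \<in> verts S" "z \<in> verts S" "\<not> linked S F x y"
  shows "linked S F x z \<longleftrightarrow> \<not> linked S F y z"
  using assms unfolding bisected_def by (metis linked_sym linked_trans)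

lemma bisectedI:
  assumes "finite_graph S" "g \<in> F" "F \<subseteq> edges S" "circuit_free S F" "spans S F"
  shows "bisected S (F - {g})"
proof -
  obtain x y where e: "ends S g = {x, y}" "x \<in> verts S" "y \<in> verts S"
    using ends_cases[OF assms(1), of g] assms(2,3) by (metis subset_iff)
  have "\<not> linked S (F - {g}) x y" using assms(2,4) e unfolding circuit_free_def by blast
  moreover have "linked S (F - {g}) x u \<or> linked S (F - {g}) y u" if "u \<in> verts S" for u
  proof -
    have "linked S (insert g (F - {g})) x u"
      using assms(2,5) e that unfolding spans_def by (simp add: insert_absorb)
    then show ?thesis unfolding linked_insert[OF e(1)] by blast
  qed
  ultimately show ?thesis using e unfolding bisected_def by blast
qed

lemma spans_insert:
  assumes "finite_graph S" "g \<in> edges S" "crosses S F g" "bisected S F"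
  shows "spans S (insert g F)"
proof -
  obtain x y where e: "ends S g = {x, y}" "x \<in> verts S" "y \<in> verts S"
    using ends_cases[OF assms(1,2)] by metis
  have n: "\<not> linked S F x y" using assms(3) e crosses_iff by metis
  have "linked S (insert g F) x u" if "u \<in> verts S" for u
    using bisected_not_linked[OF assms(4) e(2,3) that n] unfolding linked_insert[OF e(1)] by auto
  then show ?thesis unfolding spans_def by (metis linked_cong)
qed

text \<open>The roles swap: the old tree falls into two trees when it loses \<open>g\<close>, while
  \<open>g\<close> joins the two trees of \<open>F\<close> into a spanning tree.\<close>

lemma tree_complements_exchange:
  assumes "finite_graph S" "F \<in> tree_complements S" "g \<in> edges S - F" "crosses S F g"
  shows "edges S - F - {g} \<in> tree_complements S"
proof -
  have F: "F \<subseteq> edges S" "circuit_free S F" "bisected S F"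
      "circuit_free S (edges S - F)" "spans S (edges S - F)"
    using assms(2) unfolding tree_complements_def by auto
  have eq: "edges S - (edges S - F - {g}) = insert g F" using assms(3) F by blast
  have "circuit_free S (edges S - F - {g})" using F(4) by (rule circuit_free_subset) auto
  moreover have "bisected S (edges S - F - {g})" using assms F by (intro bisectedI) auto
  moreover have "circuit_free S (insert g F)"
    using assms(4) F(2) circuit_free_insert unfolding crosses_def by metis
  moreover have "spans S (insert g F)" using assms F by (intro spans_insert) auto
  ultimately show ?thesis unfolding tree_complements_def by (auto simp: eq)
qed

definition exchangeable :: "('v, 'e) graph \<Rightarrow> 'e set \<Rightarrow> 'e set \<Rightarrow> bool" where
  "exchangeable S F F' \<longleftrightarrow> (\<exists>g\<in>edges S - F. crosses S F g \<and> F' = edges S - F - {g})"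

text \<open>The same edge \<open>g\<close> leads back: the old tree has no circuit, so
  \<open>g\<close> joins the two parts left by its removal.\<close>

lemma exchangeable_sym:
  assumes "finite_graph S" "F \<in> tree_complements S" "exchangeable S F F'"
  shows "exchangeable S F' F"
proof -
  obtain g where g: "g \<in> edges S - F" "F' = edges S - F - {g}"
    using assms(3) unfolding exchangeable_def by blast
  have F: "F \<subseteq> edges S" "circuit_free S (edges S - F)"
    using assms(2) unfolding tree_complements_def by auto
  obtain x y where e: "ends S g = {x, y}" using ends_cases[OF assms(1), of g] g(1) by (metis DiffD1)
  have "\<not> linked S F' x y" using F(2) g e unfolding circuit_free_def by blast
  then have "crosses S F' g" using e crosses_iff by metis
  moreover have "g \<in> edges S - F'" "F = edges S - F' - {g}" using g F by auto
  ultimately show ?thesis unfolding exchangeable_def by blast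
qed

lemma linked_isolated:
  assumes "\<forall>h\<in>F. c \<notin> ends S h"
  shows "linked S F c z \<longleftrightarrow> z = c"
proof
  assume "linked S F c z"
  then show "z = c" unfolding linked_def
    by (induction rule: rtranclp_induct) (use assms in \<open>auto simp: adjacent_edges\<close>)
qed simp

text \<open>A neighbour of \<open>F\<close> is disjoint from \<open>F\<close>, so a fixed
  \<open>F\<close> is empty and its two parts are single vertices. A single edge on two vertices
  does give such a case, hence the bound on the number of vertices.\<close>

lemma exchangeable_irrefl:
  assumes "F \<in> tree_complements S" "\<not> card (verts S) \<le> 2"
  shows "\<not> exchangeable S F F"
proof
  assume "exchangeable S F F"
  then have "F = {}" unfolding exchangeable_def by blast
  then obtain r s where "\<forall>u\<in>verts S. linked S {} r u \<or> linked S {} s u"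
    using assms(1) unfolding tree_complements_def bisected_def by auto
  then have "verts S \<subseteq> {r, s}" by (auto simp: linked_isolated)
  then have "card (verts S) \<le> card {r, s}" by (intro card_mono) auto
  also have "\<dots> \<le> 2" by (simp add: card_insert_if)
  finally show False using assms(2) by simp
qed

text \<open>The \<open>s\<close>-\<open>t\<close>-path of the tree crosses the two parts of \<open>F\<close> an odd number of times
  iff it ends in the other part; \<open>g\<close> lies on that path iff deleting \<open>g\<close> separates \<open>s\<close> from \<open>t\<close>.\<close>

lemma odd_card_path_crossings:
  assumes "finite_graph S" "T \<subseteq> edges S" "circuit_free S T" "bisected S F"
    and "s \<in> verts S" "linked S T s t"
  shows "odd (card {g \<in> T. crosses S F g \<and> \<not> linked S (T - {g}) s t}) \<longleftrightarrow> \<not> linked S F s t"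
  using assms(6) unfolding linked_def[of S T]
proof (induction rule: rtranclp_induct)
  case (step t t')
  let ?C = "\<lambda>t. {g \<in> T. crosses S F g \<and> \<not> linked S (T - {g}) s t}"
  obtain h where h: "h \<in> T" "ends S h = {t, t'}" using step.hyps(2) by (auto simp: adjacent_edges)
  have fin: "finite T" using assms(1,2) finite_subset unfolding finite_graph_def by blast
  have st: "linked S T s t" using step.hyps(1) by (simp add: linked_def)
  then have tV: "t \<in> verts S" using assms(1,2,5) linked_verts by metis
  have t'V: "t' \<in> verts S" using linked_verts[OF assms(1,2) linked_edge[OF h] tV] .
  have other: "linked S (T - {g}) s t \<longleftrightarrow> linked S (T - {g}) s t'" if "g \<noteq> h" for g
  proof -
    have "linked S (T - {g}) t t'" using h that by (intro linked_edge) auto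
    then show ?thesis by (metis linked_cong linked_commute)
  qed
  have "linked S (insert h (T - {h})) s t" using st h(1) by (simp add: insert_absorb)
  moreover have "\<not> linked S (T - {h}) t t'" using assms(3) h unfolding circuit_free_def by blast
  \<comment> \<open>Removing \<open>h\<close> splits the tree between \<open>t\<close> and
    \<open>t'\<close>, and \<open>s\<close> stays with exactly one of them.\<close>
  ultimately have flip: "linked S (T - {h}) s t \<longleftrightarrow> \<not> linked S (T - {h}) s t'"
    unfolding linked_insert[OF h(2)] by (metis linked_sym linked_trans)
  show ?case
  proof (cases "crosses S F h")
    case True
    then have "linked S F s t \<longleftrightarrow> \<not> linked S F s t'"
      using bisected_not_linked[OF assms(4) tV t'V assms(5)] crosses_iff[OF h(2)] linked_commute
      by metis
    \<comment> \<open>Moving from \<open>t\<close> to \<open>t'\<close> changes the path only by the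
      edge \<open>h\<close>, which is appended or dropped.\<close>
    moreover have "odd (card (?C t)) \<longleftrightarrow> even (card (?C t'))"
    proof (cases "linked S (T - {h}) s t")
      case lt: True
      have "g \<in> ?C t' \<longleftrightarrow> g \<in> insert h (?C t)" for g
        using lt True h(1) other[of g] flip by (cases "g = h") auto
      then have "?C t' = insert h (?C t)" by blast
      moreover have "h \<notin> ?C t" using lt flip by auto
      ultimately show ?thesis using fin by simp
    next
      case lt: False
      have "g \<in> ?C t \<longleftrightarrow> g \<in> insert h (?C t')" for g
        using lt True h(1) other[of g] flip by (cases "g = h") auto
      then have "?C t = insert h (?C t')" by blast
      moreover have "h \<notin> ?C t'" using lt flip by auto
      ultimately show ?thesis using fin by simp
    qed
    ultimately show ?thesis using step.IH by blast
  next
    case False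
    then have "linked S F t t'" using crosses_iff[OF h(2)] by blast
    then have "linked S F s t \<longleftrightarrow> linked S F s t'" by (metis linked_cong linked_commute)
    moreover have "?C t' = ?C t" using False by (intro Collect_cong) (metis other)
    ultimately show ?thesis using step.IH by simp
  qed
qed simp

text \<open>The neighbour determines the exchanged edge, so neighbours can be counted by edges.
  \<open>P\<close> is later separation of \<open>s\<close> from \<open>t\<close>, or no restriction
  at all.\<close>

lemma card_exchangeable:
  assumes "finite_graph S" "F \<in> tree_complements S"
  shows "card {F' \<in> tree_complements S. exchangeable S F F' \<and> P F'} =
    card {g \<in> edges S - F. crosses S F g \<and> P (edges S - F - {g})}"
proof -
  have "{F' \<in> tree_complements S. exchangeable S F F' \<and> P F'} =
      (\<lambda>g. edges S - F - {g}) ` {g \<in> edges S - F. crosses S F g \<and> P (edges S - F - {g})}"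
    using tree_complements_exchange[OF assms] unfolding exchangeable_def by auto
  moreover have "inj_on (\<lambda>g. edges S - F - {g}) {g \<in> edges S - F. crosses S F g \<and> P (edges S - F - {g})}"
    by (auto simp: inj_on_def)
  ultimately show ?thesis by (simp add: card_image)
qed

lemma even_card_separating:
  assumes "finite_graph S" "\<not> card (verts S) \<le> 2" "s \<in> verts S" "t \<in> verts S"
  shows "even (card {F \<in> tree_complements S. \<not> linked S F s t \<and>
    odd (card {g \<in> edges S - F. crosses S F g})})"
proof -
  let ?X = "tree_complements S" and ?Y = "{F \<in> tree_complements S. \<not> linked S F s t}"
  have "finite (Pow (edges S))" using assms(1) unfolding finite_graph_def by blast
  then have "finite ?X" by (rule finite_subset[rotated]) (auto simp: tree_complements_def)
  then have "even (card {F \<in> ?Y. odd (card {F' \<in> ?X. exchangeable S F F'})})"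
  proof (rule even_card_odd_degree)
    fix F assume F: "F \<in> ?X"
    have "card {F' \<in> ?Y. exchangeable S F F'} =
        card {g \<in> edges S - F. crosses S F g \<and> \<not> linked S (edges S - F - {g}) s t}"
      using card_exchangeable[OF assms(1) F, of "\<lambda>F'. \<not> linked S F' s t"]
      by (simp add: conj_ac)
    moreover have "odd (card {g \<in> edges S - F. crosses S F g \<and> \<not> linked S (edges S - F - {g}) s t})
        \<longleftrightarrow> \<not> linked S F s t"
      using F assms unfolding tree_complements_def spans_def
      by (intro odd_card_path_crossings) auto
    ultimately show "odd (card {F' \<in> ?Y. exchangeable S F F'}) \<longleftrightarrow> F \<in> ?Y" using F by simp
  qed (use exchangeable_sym[OF assms(1)] exchangeable_irrefl[OF _ assms(2)] in auto)
  moreover have "{F \<in> ?Y. odd (card {F' \<in> ?X. exchangeable S F F'})} =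
      {F \<in> ?X. \<not> linked S F s t \<and> odd (card {g \<in> edges S - F. crosses S F g})}"
    using card_exchangeable[OF assms(1), of _ "\<lambda>_. True"] by auto
  ultimately show ?thesis by simp
qed

section \<open>Exchanging the two edges at a vertex\<close>

text \<open>In \<open>F\<close> the vertex \<open>c\<close> is isolated, so \<open>g\<close> makes
  it a leaf that inherits the links of \<open>p\<close>.\<close>

lemma linked_pendant:
  assumes "ends S g = {c, p}" "\<forall>h\<in>F. c \<notin> ends S h"
  shows "u \<noteq> c \<Longrightarrow> z \<noteq> c \<Longrightarrow> linked S (insert g F) u z \<longleftrightarrow> linked S F u z"
    and "z \<noteq> c \<Longrightarrow> linked S (insert g F) c z \<longleftrightarrow> linked S F p z"
proof -
  note iso = linked_isolated[OF assms(2)]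
  show "u \<noteq> c \<Longrightarrow> z \<noteq> c \<Longrightarrow> linked S (insert g F) u z \<longleftrightarrow> linked S F u z"
    and "z \<noteq> c \<Longrightarrow> linked S (insert g F) c z \<longleftrightarrow> linked S F p z"
    unfolding linked_insert[OF assms(1)] using iso linked_sym linked_refl by metis+
qed

lemma circuit_free_pendant:
  assumes "circuit_free S F" "ends S g = {c, p}" "p \<noteq> c" "\<forall>h\<in>F. c \<notin> ends S h"
  shows "circuit_free S (insert g F)"
proof -
  have "\<not> linked S F c p" using linked_isolated[OF assms(4)] assms(3) by blast
  with assms(1,2) show ?thesis by (rule circuit_free_insert)
qed

lemma bisected_move_pendant:
  assumes "bisected S (insert g F)" "ends S g = {c, p}" "p \<noteq> c" "ends S h = {c, q}" "q \<noteq> c"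
    and "p \<in> verts S" "q \<in> verts S" "\<forall>k\<in>F. c \<notin> ends S k"
  shows "bisected S (insert h F)"
proof -
  note g = linked_pendant[OF assms(2,8)] and h = linked_pendant[OF assms(4,8)]
  have cp: "linked S (insert g F) c p" using assms(2) by (intro linked_edge) auto
  obtain r s where rs: "r \<in> verts S" "s \<in> verts S" "\<not> linked S (insert g F) r s"
      "\<And>u. u \<in> verts S \<Longrightarrow> linked S (insert g F) r u \<or> linked S (insert g F) s u"
    using assms(1) unfolding bisected_def by blast
  \<comment> \<open>A representative equal to \<open>c\<close> is replaced by \<open>p\<close>,
    since only links away from \<open>c\<close> survive the move.\<close>
  obtain r' where r': "r' \<in> verts S" "r' \<noteq> c" "linked S (insert g F) r r'"
    using rs(1) cp assms(3,6) by (metis linked_refl)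
  obtain s' where s': "s' \<in> verts S" "s' \<noteq> c" "linked S (insert g F) s s'"
    using rs(2) cp assms(3,6) by (metis linked_refl)
  have n: "\<not> linked S F r' s'"
    using rs(3) r' s' g(1) by (metis linked_sym linked_trans)
  have l: "linked S F r' u \<or> linked S F s' u" if "u \<in> verts S" "u \<noteq> c" for u
    using rs(4)[OF that(1)] r' s' that g(1) by (metis linked_cong)
  have "linked S (insert h F) r' u \<or> linked S (insert h F) s' u" if "u \<in> verts S" for u
  proof (cases "u = c")
    case True
    then show ?thesis using l[OF assms(7,5)] h(2) r'(2) s'(2) linked_sym by metis
  next
    case False
    then show ?thesis using l[OF that] h(1) r' s' by metis
  qed
  moreover have "\<not> linked S (insert h F) r' s'" using n h(1) r' s' by metis
  ultimately show ?thesis using r'(1) s'(1) unfolding bisected_def by blast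
qed

lemma spans_move_pendant:
  assumes "spans S (insert g F)" "ends S g = {c, p}" "ends S h = {c, q}" "q \<noteq> c"
    and "q \<in> verts S" "\<forall>k\<in>F. c \<notin> ends S k"
  shows "spans S (insert h F)"
proof -
  note g = linked_pendant[OF assms(2,6)] and h = linked_pendant[OF assms(3,6)]
  have "linked S (insert h F) q u" if "u \<in> verts S" for u
  proof (cases "u = c")
    case True
    have "linked S (insert h F) c q" using assms(3) by (intro linked_edge) auto
    then show ?thesis using True linked_sym by metis
  next
    case False
    have "linked S (insert g F) q u" using assms(1,5) that unfolding spans_def by blast
    then show ?thesis using False g(1) h(1) assms(4) by metis
  qed
  then show ?thesis unfolding spans_def by (metis linked_cong)
qed

text \<open>With one of its two edges in \<open>F\<close> and the other in the tree,
  \<open>c\<close> is a leaf of both. Swapping the edges merely reattaches these leaves.\<close>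

lemma tree_complements_move_pendant:
  assumes "finite_graph S" "F \<in> tree_complements S" "g \<in> F" "h \<in> edges S - F"
    and "{x \<in> edges S. c \<in> ends S x} = {g, h}"
    and "ends S g = {c, p}" "p \<noteq> c" "ends S h = {c, q}" "q \<noteq> c"
  shows "insert h (F - {g}) \<in> tree_complements S"
proof -
  have F: "F \<subseteq> edges S" "circuit_free S F" "bisected S F"
      "circuit_free S (edges S - F)" "spans S (edges S - F)"
    using assms(2) unfolding tree_complements_def by auto
  have V: "p \<in> verts S" "q \<in> verts S"
    using assms(1,3,4,6,8) F(1) unfolding finite_graph_def by blast+
  let ?F = "F - {g}" and ?T = "edges S - F - {h}"
  have inc: "k = g \<or> k = h" if "k \<in> edges S" "c \<in> ends S k" for k
    using that assms(5) by blast
  have iso: "\<forall>k\<in>?F. c \<notin> ends S k" using inc assms(4) F(1) by blast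
  have isoT: "\<forall>k\<in>?T. c \<notin> ends S k" using inc assms(3) by blast
  have eqF: "insert g ?F = F" and eqT: "insert h ?T = edges S - F"
    and eq: "edges S - insert h ?F = insert g ?T"
    using assms(3,4) F(1) by auto
  have "circuit_free S ?F" using F(2) by (rule circuit_free_subset) auto
  then have "circuit_free S (insert h ?F)" using assms(8,9) iso by (rule circuit_free_pendant)
  moreover have "bisected S (insert g ?F)" using F(3) by (simp only: eqF)
  then have "bisected S (insert h ?F)" using assms(6-9) V iso by (rule bisected_move_pendant)
  moreover have "circuit_free S ?T" using F(4) by (rule circuit_free_subset) auto
  then have "circuit_free S (insert g ?T)" using assms(6,7) isoT by (rule circuit_free_pendant)
  moreover have "spans S (insert h ?T)" using F(5) by (simp only: eqT)
  then have "spans S (insert g ?T)" using assms(8,6,7) V(1) isoT by (rule spans_move_pendant)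
  moreover have "insert h ?F \<subseteq> edges S" using assms(4) F(1) by blast
  ultimately show ?thesis unfolding tree_complements_def by (auto simp: eq)
qed

text \<open>Rerouting the pendant edge at \<open>c\<close> changes the part containing \<open>c\<close> exactly when \<open>p\<close> and \<open>q\<close>
  are separated, and then the two parts of \<open>M\<close> are exchanged. So the forests with \<open>3\<close> vertices of
  \<open>M\<close> on the side of \<open>c\<close> pair up, up to those counted by \<open>even_card_separating\<close>.\<close>

lemma even_card_three_linked:
  assumes fin: "finite_graph S" and c: "c \<in> verts S"
    and M: "M \<subseteq> verts S" "c \<notin> M" "card M = 4"
    and inc: "{x \<in> edges S. c \<in> ends S x} = {g, h}" "g \<noteq> h"
    and g: "ends S g = {c, p}" "p \<noteq> c" and h: "ends S h = {c, q}" "q \<noteq> c"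
    and par: "\<And>F. F \<in> tree_complements S \<Longrightarrow>
      odd (card {x \<in> edges S - F. crosses S F x}) \<longleftrightarrow> odd (card {u \<in> M. linked S F c u})"
  shows "even (card {F \<in> tree_complements S. card {u \<in> M. linked S F c u} = 3})"
proof -
  let ?X = "tree_complements S"
  define K where "K F = card {u \<in> M. linked S F c u}" for F
  define Z where "Z = {F \<in> ?X. K F = 3}"
  define U where "U = {F \<in> ?X. g \<in> F \<and> h \<notin> F}"
  define U' where "U' = {F \<in> ?X. h \<in> F \<and> g \<notin> F}"
  define \<sigma> where "\<sigma> F = insert h (F - {g})" for F
  have finM: "finite M" using M(3) card.infinite by fastforce
  have inc': "x = g \<or> x = h" if "x \<in> edges S" "c \<in> ends S x" for x
    using that inc(1) by blast
  have ghE: "g \<in> edges S" "h \<in> edges S" using inc by auto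
  have V: "p \<in> verts S" "q \<in> verts S"
    using fin ghE g h unfolding finite_graph_def by blast+
  have sub: "F \<subseteq> edges S" if "F \<in> ?X" for F using that unfolding tree_complements_def by blast
  have finX: "finite ?X"
    by (rule finite_subset[of _ "Pow (edges S)"]) (use fin sub in \<open>auto simp: finite_graph_def\<close>)
  \<comment> \<open>A marked vertex on the side of \<open>c\<close> prevents \<open>c\<close> from
    being isolated in \<open>F\<close>, and spanning prevents it in the tree. So each of the two
    receives exactly one edge at \<open>c\<close>.\<close>
  have one: "g \<in> F \<longleftrightarrow> h \<notin> F" if F: "F \<in> ?X" and K: "K F \<noteq> 0" for F
  proof
    obtain u where u: "u \<in> M" "linked S F c u" 
      using K unfolding K_def by (metis (no_types, lifting) card.empty empty_Collect_eq)
    have uV: "u \<in> verts S" "u \<noteq> c" using u(1) M by auto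
    show "h \<notin> F" if "g \<in> F"
    proof
      assume "h \<in> F"
      then have "\<forall>x\<in>edges S - F. c \<notin> ends S x" using that inc' by blast
      then have "\<not> linked S (edges S - F) c u" using linked_isolated[of "edges S - F" c S u] uV by blast
      then show False using F uV c unfolding tree_complements_def spans_def by blast
    qed
    show "g \<in> F" if "h \<notin> F"
    proof (rule ccontr)
      assume "g \<notin> F"
      then have "\<forall>x\<in>F. c \<notin> ends S x" using that inc' sub[OF F] by blast
      then show False using linked_isolated[of F c S u] u uV by blast
    qed
  qed
  have bij: "bij_betw \<sigma> U U'"
  proof (rule bij_betw_byWitness[where f' = "\<lambda>F. insert g (F - {h})"])
    show "\<sigma> ` U \<subseteq> U'"
      using tree_complements_move_pendant[OF fin _ _ _ inc(1) g h] ghE inc(2)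
      unfolding U_def U'_def \<sigma>_def by auto
    show "(\<lambda>F. insert g (F - {h})) ` U' \<subseteq> U"
      using tree_complements_move_pendant[OF fin _ _ _ _ h g] inc(1) ghE inc(2)
      unfolding U_def U'_def by (auto simp: insert_commute)
  qed (auto simp: U_def U'_def \<sigma>_def inc(2))
  then have "bij_betw \<sigma> {F \<in> U. \<sigma> F \<in> Z} (Z \<inter> U')"
    by (rule bij_betw_subset) (use bij in \<open>auto simp: bij_betw_def\<close>)
  then have "card (Z \<inter> U') = card {F \<in> U. \<sigma> F \<in> Z}" by (metis bij_betw_same_card)
  moreover have "Z = (Z \<inter> U) \<union> (Z \<inter> U')" "(Z \<inter> U) \<inter> (Z \<inter> U') = {}"
    using one unfolding Z_def U_def U'_def by fastforce+
  then have "card Z = card (Z \<inter> U) + card (Z \<inter> U')"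
    using finX card_Un_disjoint[of "Z \<inter> U" "Z \<inter> U'"] unfolding Z_def by simp
  ultimately have cardZ: "card Z = card (Z \<inter> U) + card {F \<in> U. \<sigma> F \<in> Z}" by simp
  \<comment> \<open>If \<open>p\<close> and \<open>q\<close> are linked in \<open>F\<close>, then
    \<open>K\<close> is unchanged. Otherwise it becomes \<open>4 - K F\<close>, which exchanges 1
    and 3 and fixes or exchanges the even values among themselves.\<close>
  have step: "(F \<in> Z \<longleftrightarrow> \<sigma> F \<notin> Z) \<longleftrightarrow> \<not> linked S F c q \<and> odd (K F)" if F: "F \<in> U" for F
  proof -
    let ?F = "F - {g}"
    have X: "F \<in> ?X" "\<sigma> F \<in> ?X" and gF: "g \<in> F" "h \<notin> F" and eq: "insert g ?F = F"
      using F bij unfolding U_def U'_def bij_betw_def by auto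
    have iso: "\<forall>k\<in>?F. c \<notin> ends S k"
      using inc' gF sub[OF X(1)] by blast
    note pg = linked_pendant[OF g(1) iso, unfolded eq]
      and ph = linked_pendant[OF h(1) iso, folded \<sigma>_def]
    have Mc: "u \<noteq> c" "u \<in> verts S" if "u \<in> M" for u using that M by auto
    show ?thesis
    proof (cases "linked S F p q")
      case True
      then have pq: "linked S ?F p q" using pg(1)[OF g(2) h(2)] by simp
      have "linked S F c u \<longleftrightarrow> linked S (\<sigma> F) c u" if "u \<in> M" for u
        using pg(2)[of u] ph(2)[of u] Mc[OF that] linked_cong[OF pq] by simp
      then have "K F = K (\<sigma> F)" unfolding K_def
        by (intro arg_cong[of _ _ card] Collect_cong) blast
      moreover have "linked S F c q" using pg(2)[OF h(2)] pq by simp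
      ultimately show ?thesis using X unfolding Z_def by simp
    next
      case False
      have "bisected S F" using X(1) unfolding tree_complements_def by blast
      then have "linked S F p u \<longleftrightarrow> \<not> linked S F q u" if "u \<in> M" for u
        using bisected_not_linked[OF _ V _ False] Mc[OF that] by blast
      then have "linked S F c u \<longleftrightarrow> \<not> linked S (\<sigma> F) c u" if "u \<in> M" for u
        using that pg(1)[OF g(2), of u] pg(1)[OF h(2), of u] pg(2)[of u] ph(2)[of u] Mc[OF that]
        by blast
      then have "{u \<in> M. linked S (\<sigma> F) c u} = M - {u \<in> M. linked S F c u}" by auto
      then have "K (\<sigma> F) = 4 - K F"
        using M(3) finM unfolding K_def by (simp add: card_Diff_subset)
      moreover have "K F \<le> 4"
        using M(3) finM card_mono[of M "{u \<in> M. linked S F c u}"] unfolding K_def by auto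
      then have "K F \<in> {0, 1, 2, 3, 4}" by auto
      moreover have "\<not> linked S F c q" using pg(2)[OF h(2)] pg(1)[OF g(2) h(2)] False by blast
      ultimately show ?thesis using X unfolding Z_def by auto
    qed
  qed
  \<comment> \<open>The forests of \<open>U\<close> for which only one of \<open>F\<close> and
    \<open>\<sigma> F\<close> lies in \<open>Z\<close> are those of
    \<open>even_card_separating\<close> for \<open>c\<close> and \<open>q\<close>, with the parity
    of crossings translated by \<open>par\<close>.\<close>
  have "{F \<in> U. F \<in> Z \<longleftrightarrow> \<sigma> F \<notin> Z} =
      {F \<in> ?X. \<not> linked S F c q \<and> odd (card {x \<in> edges S - F. crosses S F x})}"
    (is "?L = ?R")
  proof
    show "?L \<subseteq> ?R" using step par unfolding U_def K_def by blast
    show "?R \<subseteq> ?L"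
    proof
      fix F assume "F \<in> ?R"
      then have F: "F \<in> ?X" "\<not> linked S F c q" "odd (K F)" using par unfolding K_def by auto
      have "h \<notin> F" using F(2) h(1) linked_edge by metis
      moreover have "K F \<noteq> 0" using F(3) by (metis even_zero)
      ultimately have "F \<in> U" using one F(1) unfolding U_def by blast
      then show "F \<in> ?L" using step F by blast
    qed
  qed
  moreover have "\<not> card (verts S) \<le> 2"
    using M fin card_mono[of "verts S" M] unfolding finite_graph_def by auto
  ultimately have even: "even (card {F \<in> U. F \<in> Z \<longleftrightarrow> \<sigma> F \<notin> Z})"
    using even_card_separating[OF fin _ c V(2)] by simp
  have finU: "finite U" using finX unfolding U_def by simp
  let ?A = "{F \<in> U. F \<in> Z \<and> \<sigma> F \<notin> Z}" and ?B = "{F \<in> U. F \<notin> Z \<and> \<sigma> F \<in> Z}"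
    and ?C = "{F \<in> U. F \<in> Z \<and> \<sigma> F \<in> Z}"
  have un: "Z \<inter> U = ?A \<union> ?C" "{F \<in> U. \<sigma> F \<in> Z} = ?B \<union> ?C"
      "{F \<in> U. F \<in> Z \<longleftrightarrow> \<sigma> F \<notin> Z} = ?A \<union> ?B"
    and dis: "?A \<inter> ?C = {}" "?B \<inter> ?C = {}" "?A \<inter> ?B = {}"
    by auto
  \<comment> \<open>In the count over \<open>U\<close>, forests with both \<open>F\<close> and
    \<open>\<sigma> F\<close> in \<open>Z\<close> contribute twice, so only the unpaired ones matter
    modulo 2.\<close>
  have "card Z = card {F \<in> U. F \<in> Z \<longleftrightarrow> \<sigma> F \<notin> Z} + 2 * card ?C"
    unfolding cardZ un using finU dis by (simp add: card_Un_disjoint)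
  then show ?thesis using even unfolding Z_def K_def by simp
qed

section \<open>Tree-forest pairs in terms of \<open>tree_complements\<close>\<close>

lemma components_edges:
  "components (S\<lparr>edges := F\<rparr>) = (\<lambda>u. {z \<in> verts S. linked S F u z}) ` verts S"
  unfolding components_def quotient_def reachable_def linked_def by auto

lemma spanning_tree_iff:
  assumes "finite_graph S"
  shows "spanning_tree S F \<longleftrightarrow> F \<subseteq> edges S \<and> verts S \<noteq> {} \<and> spans S F \<and> circuit_free S F"
  using forest_iff_circuit_free[OF assms]
  unfolding spanning_tree_def tree_def connected_graph_def reachable_def spans_def linked_def
  by auto

text \<open>The two trees must be the classes of \<open>y\<close> and of \<open>c\<close>, so links
  from \<open>c\<close> decide compatibility.\<close>

lemma compatible_singleton_iff:
  assumes "y \<in> verts S" "c \<in> P" "P \<subseteq> verts S"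
  shows "compatible S F {y} P \<longleftrightarrow>
    bisected S F \<and> \<not> linked S F c y \<and> (\<forall>u\<in>P. linked S F c u)"
proof
  assume "compatible S F {y} P"
  then obtain T1 T2 where T: "components (S\<lparr>edges := F\<rparr>) = {T1, T2}"
      "y \<in> T1" "P \<subseteq> T2" "y \<notin> T2"
    unfolding compatible_def by auto
  have "T1 \<in> (\<lambda>u. {z \<in> verts S. linked S F u z}) ` verts S"
      "T2 \<in> (\<lambda>u. {z \<in> verts S. linked S F u z}) ` verts S"
    using T(1) unfolding components_edges by simp_all
  then obtain r s where rs: "r \<in> verts S" "T1 = {z \<in> verts S. linked S F r z}"
      "s \<in> verts S" "T2 = {z \<in> verts S. linked S F s z}" by auto
  have "linked S F r u \<or> linked S F s u" if "u \<in> verts S" for u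
  proof -
    have "{z \<in> verts S. linked S F u z} \<in> {T1, T2}"
      using that unfolding T(1)[unfolded components_edges, symmetric] by (rule imageI)
    moreover have "u \<in> {z \<in> verts S. linked S F u z}" using that by simp
    ultimately have "u \<in> T1 \<or> u \<in> T2" by auto
    then show ?thesis using rs(2,4) by auto
  qed
  moreover have "\<not> linked S F s y" "linked S F r y" using T rs assms(1) by auto
  moreover have sP: "linked S F s u" if "u \<in> P" for u using that T rs by blast
  ultimately show "bisected S F \<and> \<not> linked S F c y \<and> (\<forall>u\<in>P. linked S F c u)"
    using rs(1,3) assms(2) unfolding bisected_def by (metis linked_sym linked_trans)
next
  assume R: "bisected S F \<and> \<not> linked S F c y \<and> (\<forall>u\<in>P. linked S F c u)"
  let ?cls = "\<lambda>u. {z \<in> verts S. linked S F u z}"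
  have cV: "c \<in> verts S" using assms by blast
  have "?cls u = ?cls y \<or> ?cls u = ?cls c" if "u \<in> verts S" for u
  proof -
    have "linked S F y u \<or> linked S F c u"
      using R bisected_not_linked[of S F c y u] cV assms(1) that by blast
    then show ?thesis using linked_cong[of S F y u] linked_cong[of S F c u] by auto
  qed
  then have "components (S\<lparr>edges := F\<rparr>) = {?cls y, ?cls c}"
    unfolding components_edges using cV assms(1) by blast
  moreover have "y \<in> ?cls y" "y \<notin> ?cls c" "P \<subseteq> ?cls c" using R assms by auto
  moreover have "P \<inter> ?cls y = {}" using R by (auto dest: linked_sym linked_trans)
  moreover have "?cls y \<noteq> ?cls c" using \<open>y \<in> ?cls y\<close> \<open>y \<notin> ?cls c\<close> by blast
  ultimately show "compatible S F {y} P"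
    unfolding compatible_def by (intro exI[of _ "?cls y"] exI[of _ "?cls c"]) auto
qed

text \<open>The tree is recovered as a complement, and compatibility only asks which vertices of
  \<open>M\<close> lie on the side of \<open>c\<close>. This makes all four families subsets of one
  set of forests.\<close>

lemma tree_forest_pairs_eq:
  assumes "finite_graph S" "M \<subseteq> verts S" "c \<in> verts S" "y \<in> M"
  shows "tree_forest_pairs S {y} (insert c (M - {y})) = (\<lambda>F. (edges S - F, F)) `
    {F \<in> tree_complements S. {u \<in> M. linked S F c u} = M - {y}}"
proof -
  have comp: "compatible S F {y} (insert c (M - {y})) \<longleftrightarrow>
      bisected S F \<and> {u \<in> M. linked S F c u} = M - {y}" for F
    using compatible_singleton_iff[of y S c "insert c (M - {y})" F] assms by auto
  have two: "card (components (S\<lparr>edges := F\<rparr>)) = 2" if "compatible S F P Q" for F P Q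
    using that unfolding compatible_def by (metis card_2_iff)
  have "(T, F) \<in> tree_forest_pairs S {y} (insert c (M - {y})) \<longleftrightarrow>
      T = edges S - F \<and> F \<in> tree_complements S \<and> {u \<in> M. linked S F c u} = M - {y}" for T F
  proof -
    have "T \<union> F = edges S \<and> T \<inter> F = {} \<longleftrightarrow> T = edges S - F \<and> F \<subseteq> edges S" by blast
    then show ?thesis
      using comp[of F] two[of F] forest_iff_circuit_free[OF assms(1), of F] assms(3)
      unfolding tree_forest_pairs_def spanning_tree_iff[OF assms(1)] spanning_2_forest_def
        tree_complements_def by auto
  qed
  then show ?thesis by auto
qed

section \<open>Degree parity in the 4-regular graph\<close>

text \<open>The degree sum over \<open>A\<close> counts every edge by its ends in \<open>A\<close>,
  a loop twice. The odd contributions are exactly those of edges leaving \<open>A\<close>.\<close>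

lemma even_card_boundary:
  assumes "finite_graph G" "A \<subseteq> verts G" "\<And>u. u \<in> A \<Longrightarrow> even (degree G u)"
  shows "even (card {x \<in> edges G. ends G x \<inter> A \<noteq> {} \<and> \<not> ends G x \<subseteq> A})"
proof -
  have fin: "finite A" "finite (edges G)"
    using assms(1,2) finite_subset unfolding finite_graph_def by auto
  have "even (\<Sum>u\<in>A. degree G u)" using assms(3) by (rule dvd_sum)
  also have "(\<Sum>u\<in>A. degree G u) =
      (\<Sum>x\<in>edges G. card {u \<in> A. u \<in> ends G x} + card {u \<in> A. ends G x = {u}})"
    unfolding degree_def sum.distrib by (simp only: sum_card_swap[OF fin])
  finally have "even (card {x \<in> edges G.
      odd (card {u \<in> A. u \<in> ends G x} + card {u \<in> A. ends G x = {u}})})"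
    by (simp only: even_sum_iff[OF fin(2)])
  moreover have "odd (card {u \<in> A. u \<in> ends G x} + card {u \<in> A. ends G x = {u}}) \<longleftrightarrow>
      ends G x \<inter> A \<noteq> {} \<and> \<not> ends G x \<subseteq> A" if x: "x \<in> edges G" for x
  proof -
    obtain p q where e: "ends G x = {p, q}" using ends_cases[OF assms(1) x] by metis
    have 1: "{u \<in> A. u \<in> ends G x} = {p, q} \<inter> A" using e by auto
    have 2: "{u \<in> A. ends G x = {u}} = (if p = q then {p} \<inter> A else {})" using e by auto
    show ?thesis unfolding 1 2 by (auto simp: e Int_insert_left)
  qed
  then have "{x \<in> edges G. odd (card {u \<in> A. u \<in> ends G x} + card {u \<in> A. ends G x = {u}})} =
      {x \<in> edges G. ends G x \<inter> A \<noteq> {} \<and> \<not> ends G x \<subseteq> A}"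
    by (intro Collect_cong conj_cong refl)
  ultimately show ?thesis by (simp only:)
qed

text \<open>As many edges as neighbours and no loop at \<open>u\<close> means no parallel edges
  there, so \<open>h\<close> matches neighbours with incident edges.\<close>

lemma card_incident_boundary:
  assumes "finite_graph G" "neighbours G u = N" "finite N" "u \<notin> N" "degree G u = card N" "u \<notin> A"
  shows "card {x \<in> edges G. u \<in> ends G x \<and> ends G x \<inter> A \<noteq> {}} = card (N \<inter> A)"
proof -
  let ?D = "{x \<in> edges G. u \<in> ends G x}"
  have noloop: "{x \<in> edges G. ends G x = {u}} = {}"
    using assms(2,4) unfolding neighbours_def adjacent_def by auto
  have card: "card ?D = card N" using assms(5) unfolding degree_def noloop by simp
  have "\<forall>z\<in>N. \<exists>x\<in>edges G. ends G x = {u, z}"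
    using assms(2) unfolding neighbours_def adjacent_def by auto
  then obtain h where h: "\<And>z. z \<in> N \<Longrightarrow> h z \<in> edges G \<and> ends G (h z) = {u, z}" by metis
  have inj: "inj_on h N"
  proof (rule inj_onI)
    fix y z assume "y \<in> N" "z \<in> N" "h y = h z"
    then have "{u, y} = {u, z}" using h by metis
    then show "y = z" by (auto simp: doubleton_eq_iff)
  qed
  have "finite ?D" using assms(1) unfolding finite_graph_def by simp
  then have D: "h ` N = ?D"
    by (rule card_subset_eq) (use h inj card in \<open>auto simp: card_image\<close>)
  have "{x \<in> edges G. u \<in> ends G x \<and> ends G x \<inter> A \<noteq> {}} = {x \<in> ?D. ends G x \<inter> A \<noteq> {}}" by blast
  also have "\<dots> = h ` (N \<inter> A)" unfolding D[symmetric] using h assms(6) by auto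
  finally show ?thesis using inj by (simp add: card_image inj_on_Int)
qed

lemma neighbours_verts: "finite_graph G \<Longrightarrow> neighbours G u \<subseteq> verts G"
  unfolding neighbours_def adjacent_def finite_graph_def by blast

lemma finite_graph_delete_verts: "finite_graph G \<Longrightarrow> finite_graph (delete_verts G X)"
  unfolding finite_graph_def delete_verts_def by auto

text \<open>\<open>A\<close> is one of the two parts of \<open>F\<close>. Edges of \<open>F\<close>
  stay inside a part, so every edge leaving \<open>A\<close> belongs to the tree.\<close>

lemma crossing_eq_boundary:
  assumes "finite_graph S" "F \<in> tree_complements S" "c \<in> verts S"
    and "A = {u \<in> verts S. linked S F c u}"
  shows "{x \<in> edges S - F. crosses S F x} =
    {x \<in> edges S. ends S x \<inter> A \<noteq> {} \<and> \<not> ends S x \<subseteq> A}"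
proof -
  have F: "F \<subseteq> edges S" "bisected S F" using assms(2) unfolding tree_complements_def by auto
  have "x \<notin> F \<and> crosses S F x \<longleftrightarrow> ends S x \<inter> A \<noteq> {} \<and> \<not> ends S x \<subseteq> A" if x: "x \<in> edges S" for x
  proof -
    obtain y z where e: "ends S x = {y, z}" "y \<in> verts S" "z \<in> verts S"
      using ends_cases[OF assms(1) x] by metis
    have "x \<in> F \<Longrightarrow> linked S F y z" using e(1) linked_edge by metis
    moreover have "ends S x \<inter> A \<noteq> {} \<and> \<not> ends S x \<subseteq> A \<longleftrightarrow> (linked S F c y \<longleftrightarrow> \<not> linked S F c z)"
      using e assms(4) by auto
    moreover have "(linked S F c y \<longleftrightarrow> \<not> linked S F c z) \<longleftrightarrow> \<not> linked S F y z"
      using bisected_not_linked[OF F(2) e(2,3) assms(3)] linked_cong[of S F y z c]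
        linked_commute[of S F c] by blast
    ultimately show ?thesis using crosses_iff[OF e(1)] by blast
  qed
  then show ?thesis by blast
qed

text \<open>A loop would have to lie in the forest or in the tree, and neither admits one.\<close>

lemma loop_imp_tree_complements_empty:
  assumes "x \<in> edges S" "ends S x = {u}"
  shows "tree_complements S = {}"
proof -
  have loop: "\<not> circuit_free S F" if "x \<in> F" for F
    using that assms(2) linked_refl[of S "F - {x}" u] unfolding circuit_free_def by (metis insert_absorb2)
  have "F \<notin> tree_complements S" for F
    using loop[of F] loop[of "edges S - F"] assms(1) unfolding tree_complements_def by auto
  then show ?thesis by blast
qed

section \<open>The deleted pair and its marked neighbours\<close>

locale adjacent_pair =
  fixes G S :: "('v, 'e) graph" and v w a b c d e :: 'v
  assumes finite: "finite_graph G"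
    and regular: "regular 4 G"
    and v: "v \<in> verts G" and w: "w \<in> verts G"
    and nw: "neighbours G w = {v, a, b, c}"
    and nv: "neighbours G v = {w, c, d, e}"
    and distinct: "distinct [v, w, a, b, c, d, e]"
    and S: "S = delete_verts G {v, w}"
begin

abbreviation M :: "'v set" where "M \<equiv> {a, b, d, e}"

lemma finite_S: "finite_graph S"
  using finite_graph_delete_verts[OF finite] S by simp

lemma verts_S: "verts S = verts G - {v, w}" and edges_S: "edges S = {x \<in> edges G. ends G x \<inter> {v, w} = {}}"
  and ends_S: "ends S = ends G"
  by (simp_all add: S delete_verts_def)

lemma marked_verts: "insert c M \<subseteq> verts S"
  using neighbours_verts[OF finite, of w] neighbours_verts[OF finite, of v] nw nv distinct verts_S by auto

text \<open>An edge containing both \<open>v\<close> and \<open>w\<close> has no end in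
  \<open>A\<close>, so the three kinds of edges do not overlap.\<close>

lemma card_boundary_split:
  assumes "v \<notin> A" "w \<notin> A"
  shows "card {x \<in> edges G. ends G x \<inter> A \<noteq> {} \<and> P x} =
    card {x \<in> edges S. ends S x \<inter> A \<noteq> {} \<and> P x} +
    card {x \<in> edges G. w \<in> ends G x \<and> ends G x \<inter> A \<noteq> {} \<and> P x} +
    card {x \<in> edges G. v \<in> ends G x \<and> ends G x \<inter> A \<noteq> {} \<and> P x}"
    (is "card ?L = card ?B + card ?W + card ?V")
proof -
  have fin: "finite (edges G)" using finite unfolding finite_graph_def by blast
  have "?W \<inter> ?V = {}"
  proof (rule equals0I)
    fix x assume x: "x \<in> ?W \<inter> ?V"
    then obtain y z where "ends G x = {y, z}" using ends_cases[OF finite, of x] by blast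
    then have "ends G x = {v, w}" using x distinct by auto
    then show False using x assms by auto
  qed
  moreover have "?B \<inter> (?W \<union> ?V) = {}" "?L = ?B \<union> (?W \<union> ?V)"
    unfolding edges_S ends_S by auto
  moreover have "finite ?B" unfolding edges_S using fin by simp
  ultimately show ?thesis using fin by (simp add: card_Un_disjoint)
qed

lemma card_incident:
  assumes "v \<notin> A" "w \<notin> A"
  shows "card {x \<in> edges G. w \<in> ends G x \<and> ends G x \<inter> A \<noteq> {}} = card ({a, b, c} \<inter> A)"
    and "card {x \<in> edges G. v \<in> ends G x \<and> ends G x \<inter> A \<noteq> {}} = card ({c, d, e} \<inter> A)"
proof -
  have "degree G w = card {v, a, b, c}" "degree G v = card {w, c, d, e}"
    using regular v w distinct unfolding regular_def by auto
  then show "card {x \<in> edges G. w \<in> ends G x \<and> ends G x \<inter> A \<noteq> {}} = card ({a, b, c} \<inter> A)"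
    and "card {x \<in> edges G. v \<in> ends G x \<and> ends G x \<inter> A \<noteq> {}} = card ({c, d, e} \<inter> A)"
    using card_incident_boundary[OF finite nw, of A] card_incident_boundary[OF finite nv, of A]
      assms distinct by (auto simp: Int_insert_left)
qed

lemma odd_card_crossing_iff:
  assumes "F \<in> tree_complements S"
  shows "odd (card {x \<in> edges S - F. crosses S F x}) \<longleftrightarrow> odd (card {u \<in> M. linked S F c u})"
proof -
  define A where "A = {u \<in> verts S. linked S F c u}"
  have A: "v \<notin> A" "w \<notin> A" "A \<subseteq> verts G" "c \<in> A"
    using marked_verts unfolding A_def verts_S by auto
  let ?P = "\<lambda>x. \<not> ends G x \<subseteq> A"
  have inA: "{x \<in> edges G. z \<in> ends G x \<and> ends G x \<inter> A \<noteq> {} \<and> ?P x} =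
      {x \<in> edges G. z \<in> ends G x \<and> ends G x \<inter> A \<noteq> {}}" if "z \<notin> A" for z
    using that by blast
  have "even (card {x \<in> edges G. ends G x \<inter> A \<noteq> {} \<and> ?P x})"
    by (rule even_card_boundary[OF finite A(3)]) (use regular A(3) in \<open>auto simp: regular_def\<close>)
  then have "even (card {x \<in> edges S. ends S x \<inter> A \<noteq> {} \<and> ?P x} +
      card ({a, b, c} \<inter> A) + card ({c, d, e} \<inter> A))"
    unfolding card_boundary_split[OF A(1,2)] inA[OF A(1)] inA[OF A(2)] card_incident[OF A(1,2)] .
  \<comment> \<open>\<open>c\<close> lies in \<open>A\<close> and is adjacent to both deleted
    vertices, so it contributes 2 and drops out of the parity.\<close>
  moreover have "card ({a, b, c} \<inter> A) + card ({c, d, e} \<inter> A) = card (M \<inter> A) + 2"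
    using A(4) distinct by (simp add: Int_insert_left)
  moreover have "M \<inter> A = {u \<in> M. linked S F c u}"
    using marked_verts unfolding A_def by auto
  moreover have "{x \<in> edges S - F. crosses S F x} = {x \<in> edges S. ends S x \<inter> A \<noteq> {} \<and> ?P x}"
    using crossing_eq_boundary[OF finite_S assms _ A_def] marked_verts ends_S by simp
  ultimately show ?thesis by (metis (no_types, lifting) add.assoc even_add even_numeral)
qed

text \<open>Two of the four edges at \<open>c\<close> go to \<open>v\<close> and \<open>w\<close>.
  The other two remain in \<open>S\<close>; they may be parallel, so \<open>p = q\<close> is
  possible.\<close>

lemma incident_c_cases:
  assumes "tree_complements S \<noteq> {}"
  obtains g h p q where "{x \<in> edges S. c \<in> ends S x} = {g, h}" "g \<noteq> h"
    "ends S g = {c, p}" "p \<noteq> c" "ends S h = {c, q}" "q \<noteq> c"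
proof -
  have c: "v \<notin> {c}" "w \<notin> {c}" "c \<in> verts G" using distinct marked_verts verts_S by auto
  have loop: "ends S x \<noteq> {c}" if "x \<in> edges S" for x
    using loop_imp_tree_complements_empty[OF that] assms by blast
  then have noloop: "{x \<in> edges G. ends G x = {c}} = {}" using distinct unfolding edges_S ends_S by auto
  have "degree G c = 4" using regular c(3) unfolding regular_def by simp
  then have "card {x \<in> edges G. c \<in> ends G x} = 4"
    unfolding degree_def noloop by simp
  then have "card {x \<in> edges S. c \<in> ends S x} = 2"
    using card_boundary_split[OF c(1,2), of "\<lambda>_. True"] card_incident[OF c(1,2)] by simp
  then obtain g h where gh: "{x \<in> edges S. c \<in> ends S x} = {g, h}" "g \<noteq> h"
    by (metis card_2_iff)
  have other: "\<exists>p. ends S x = {c, p} \<and> p \<noteq> c" if "x \<in> {g, h}" for x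
  proof -
    have x: "x \<in> edges S" "c \<in> ends S x" using that gh(1) by blast+
    obtain y z where "ends S x = {y, z}" using ends_cases[OF finite_S x(1)] by metis
    then show ?thesis using x(2) loop[OF x(1)] by (cases "y = c") auto
  qed
  then show ?thesis using that gh by (metis insertI1 insertI2)
qed

lemma even_card_three: "even (card {F \<in> tree_complements S. card {u \<in> M. linked S F c u} = 3})"
proof (cases "tree_complements S = {}")
  case False
  then obtain g h p q where gh: "{x \<in> edges S. c \<in> ends S x} = {g, h}" "g \<noteq> h"
      "ends S g = {c, p}" "p \<noteq> c" "ends S h = {c, q}" "q \<noteq> c"
    by (rule incident_c_cases)
  have "c \<in> verts S" "M \<subseteq> verts S" "c \<notin> M" "card M = 4" using marked_verts distinct by auto
  then show ?thesis by (rule even_card_three_linked[OF finite_S _ _ _ _ gh odd_card_crossing_iff])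
qed simp

end

section \<open>Assembling the four families\<close>

theorem theorem4p8:
  fixes G S :: "('v, 'e) graph" and v w a b c d e :: 'v
  assumes "finite_graph G"
    and "connected_graph G"
    and "regular 4 G"
    and "v \<in> verts G" and "w \<in> verts G"
    and "adjacent G v w"
    and "neighbours G w = {v, a, b, c}"
    and "neighbours G v = {w, c, d, e}"
    and "distinct [v, w, a, b, c, d, e]"
    and "S = delete_verts G {v, w}"
  shows "(\<exists>f. fixed_point_free_involution_on
            (tree_forest_pairs S {a} {b, c, d, e} \<union> tree_forest_pairs S {b} {a, c, d, e} \<union>
             tree_forest_pairs S {d} {a, b, c, e} \<union> tree_forest_pairs S {e} {a, b, c, d}) f) \<and>
         [num_tree_forest_pairs S {a} {b, c, d, e} + num_tree_forest_pairs S {b} {a, c, d, e} +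
          num_tree_forest_pairs S {d} {a, b, c, e} + num_tree_forest_pairs S {e} {a, b, c, d} = 0]
         (mod 2)"
proof -
  interpret adjacent_pair G S v w a b c d e
    by unfold_locales (use assms in auto)
  let ?X = "tree_complements S" and ?pair = "\<lambda>F. (edges S - F, F)"
  define Z where "Z y = ?pair ` {F \<in> ?X. {u \<in> M. linked S F c u} = M - {y}}" for y
  have pairs: "tree_forest_pairs S {y} (insert c (M - {y})) = Z y" if "y \<in> M" for y
    unfolding Z_def using marked_verts that by (intro tree_forest_pairs_eq[OF finite_S]) auto
  have sets: "{b, c, d, e} = insert c (M - {a})" "{a, c, d, e} = insert c (M - {b})"
      "{a, b, c, e} = insert c (M - {d})" "{a, b, c, d} = insert c (M - {e})"
    using distinct by auto
  have Z: "tree_forest_pairs S {a} {b, c, d, e} = Z a"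
      "tree_forest_pairs S {b} {a, c, d, e} = Z b"
      "tree_forest_pairs S {d} {a, b, c, e} = Z d"
      "tree_forest_pairs S {e} {a, b, c, d} = Z e"
    by (simp_all only: sets pairs insert_iff simp_thms)
  have fin: "finite ?X"
    by (rule finite_subset[of _ "Pow (edges S)"])
      (use finite_S in \<open>auto simp: finite_graph_def tree_complements_def\<close>)
  have three: "card L = 3 \<longleftrightarrow> (\<exists>y\<in>M. L = M - {y})" if "L \<subseteq> M" for L
  proof
    assume "card L = 3"
    moreover have "card M = 4" using distinct by simp
    ultimately have "card (M - L) = 1" using that by (simp add: card_Diff_subset finite_subset)
    then obtain y where "M - L = {y}" by (metis card_1_singletonE)
    then show "\<exists>y\<in>M. L = M - {y}" using that by blast
  next
    assume "\<exists>y\<in>M. L = M - {y}"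
    then show "card L = 3" using distinct by (auto simp: insert_Diff_if)
  qed
  \<comment> \<open>Three vertices of \<open>M\<close> on the side of \<open>c\<close> leave a
    single \<open>y\<close> on the other side, and the families are sorted by this
    \<open>y\<close>.\<close>
  have "{F \<in> ?X. card {u \<in> M. linked S F c u} = 3} =
      (\<Union>y\<in>M. {F \<in> ?X. {u \<in> M. linked S F c u} = M - {y}})"
    by (rule set_eqI) (simp only: mem_Collect_eq UN_iff three[OF Collect_restrict] bex_simps)
  then have un: "?pair ` {F \<in> ?X. card {u \<in> M. linked S F c u} = 3} = (\<Union>y\<in>M. Z y)"
    unfolding Z_def by (simp only: image_UN)
  have "even (card (?pair ` {F \<in> ?X. card {u \<in> M. linked S F c u} = 3}))"
    using even_card_three by (subst card_image) (auto simp: inj_on_def)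
  then have even: "even (card (\<Union>y\<in>M. Z y))" unfolding un .
  have finZ: "finite (Z y)" for y unfolding Z_def using fin by simp
  have "card (\<Union>y\<in>M. Z y) = (\<Sum>y\<in>M. card (Z y))"
  proof (rule card_UN_disjoint)
    \<comment> \<open>The forest, as second component of the pair, determines which marked vertex is
      cut off from \<open>c\<close>.\<close>
    show "\<forall>y\<in>M. \<forall>z\<in>M. y \<noteq> z \<longrightarrow> Z y \<inter> Z z = {}"
      unfolding Z_def by blast
  qed (use finZ in auto)
  also have "\<dots> = card (Z a) + card (Z b) + card (Z d) + card (Z e)"
    using distinct by simp
  finally have sum: "card (\<Union>y\<in>M. Z y) = \<dots>" .
  have "(\<Union>y\<in>M. Z y) = Z a \<union> Z b \<union> Z d \<union> Z e" by auto
  then have "\<exists>f. fixed_point_free_involution_on (Z a \<union> Z b \<union> Z d \<union> Z e) f"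
    using even_card_imp_involution[of "\<Union>y\<in>M. Z y"] even finZ by simp
  then show ?thesis
    using even sum unfolding num_tree_forest_pairs_def Z by (simp add: cong_0_iff)
qed

end
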